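(* Let $P$ be a probability distribution on $\mathbb{R}^p$ with support $\mathrm{supp}(P) = \bar\Omega$, where $\Omega \subset \mathbb{R}^p$ is bounded, open, and connected. For each $n$, let $x_1, \dots, x_n$ be drawn iid from $P$. Then there is a (deterministic) sequence $r_n \to 0$ such that, for any connectivity radii $r = r(n) \ge r_n$, the graph with node set $[n]$ and an edge between $i \neq j$ whenever $\|x_i - x_j\| \le r$ is a lateration graph in dimension $p$ with probability tending to one as $n \to \infty$.
   Context: Notation: $[n] = \{1, \dots, n\}$; $\bar\Omega$ is the closure of $\Omega$; $\|\cdot\|$ is the Euclidean norm on $\mathbb{R}^p$. Lateration graph (in dimension $p$): a graph with $n \ge p+1$ vertices that admits an ordering $v_1, \dots, v_n$ of its vertices such that the subgraph induced by $v_1, \dots, v_{p+1}$ is complete and, for each $j > p+1$, $v_j$ is connected to at least $p+1$ vertices among $v_1, \dots, v_{j-1}$. *)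

theory Defs
  imports "HOL-Probability.Probability" "Graph_Theory.Graph_Theory"
begin

text \<open>
  For Borel measures on a second-countable space this is the smallest closed set of full measure.
\<close>

definition measure_support :: "'a::topological_space measure \<Rightarrow> 'a set" where
  "measure_support P = {x. \<forall>U. open U \<and> x \<in> U \<longrightarrow> emeasure P U > 0}"

text \<open>
  The locale \<^locale>\<open>graph\<close> represents a finite simple undirected graph by the symmetric loop-free
  digraph containing both orientations of every edge.
\<close>

definition lateration_graph :: "nat \<Rightarrow> ('a, 'b) pre_digraph \<Rightarrow> bool" where
  "lateration_graph p G \<longleftrightarrow>
     graph G \<and> p + 1 \<le> card (verts G) \<and>
     (\<exists>v. bij_betw v {1..card (verts G)} (verts G) \<and>
          complete_digraph (p + 1) (G \<restriction> (v ` {1..p + 1})) \<and>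
          (\<forall>j\<in>{p + 1 <.. card (verts G)}. p + 1 \<le> card {i \<in> {1..<j}. v j \<rightarrow>\<^bsub>G\<^esub> v i}))"

definition proximity_graph ::
    "nat \<Rightarrow> (nat \<Rightarrow> 'a::real_normed_vector) \<Rightarrow> real \<Rightarrow> (nat, nat \<times> nat) pre_digraph" where
  "proximity_graph n x r = with_proj
     \<lparr>pverts = {1..n},
      parcs = {(i, j). i \<in> {1..n} \<and> j \<in> {1..n} \<and> i \<noteq> j \<and> norm (x i - x j) \<le> r}\<rparr>"

end

theory Submission
  imports Defs
begin

text \<open>
  At scale \<open>s\<close>, compactness gives a finite set \<open>C \<subseteq> \<Omega>\<close> such that the balls \<open>ball c s\<close> for
  \<open>c \<in> C\<close> cover the support of \<open>P\<close>, and each of these balls has positive mass because its centre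
  lies in the support (\<open>ball_cover_within_support\<close>). The sample almost surely stays in the union
  of the balls, and with probability tending to one every ball receives at least \<open>p + 1\<close> sample
  points (\<open>few_hits_unlikely\<close>).

  On that event every radius \<open>r \<ge> 4 * s\<close> produces a lateration graph
  (\<open>lateration_proximity_graph\<close>). Sample points in the same ball, or in two balls that overlap,
  are within distance \<open>4 * s\<close> of each other, hence adjacent. So \<open>p + 1\<close> points of one ball form a
  clique to start with, and once all points of a ball have been listed, so can be the points of every
  ball that overlaps it. Since \<open>\<Omega>\<close> is connected, its cover cannot be split into two parts
  without an overlap between them, and thus the process stops only when all vertices are listed.

  The probability of failure at scale \<open>s\<close> is bounded, uniformly in \<open>r \<ge> 4 * s\<close>, by a sequence in
  \<open>n\<close> that tends to zero. Letting the scale decrease slowly enough with \<open>n\<close>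
  (\<open>vanishing_diagonal\<close>) keeps the failure probability tending to zero, and four times that scale
  serves as \<open>r\<^sub>n\<close>.
\<close>

section \<open>An expansion criterion for lateration graphs\<close>

text \<open>
  Greedy enumeration: start with the clique \<open>K\<close> and keep appending a vertex with enough neighbours
  among those already listed; the expansion hypothesis says that this never gets stuck. The order
  of the vertices disappears from the hypotheses, which is what makes the criterion convenient for
  geometric graphs.
\<close>

lemma lateration_graphI_expansion:
  fixes G :: "('a, 'b) pre_digraph"
  assumes G: "graph G"
    and K: "K \<subseteq> verts G" "card K = p + 1"
    and clique: "\<And>u v. u \<in> K \<Longrightarrow> v \<in> K \<Longrightarrow> u \<noteq> v \<Longrightarrow> u \<rightarrow>\<^bsub>G\<^esub> v"
    and expand: "\<And>S. K \<subseteq> S \<Longrightarrow> S \<subset> verts G \<Longrightarrow>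
                   \<exists>v\<in>verts G - S. p + 1 \<le> card {u \<in> S. v \<rightarrow>\<^bsub>G\<^esub> u}"
  shows "lateration_graph p G"
proof -
  interpret graph G by (rule G)
  define N where "N = card (verts G)"
  have finK: "finite K"
    using K(1) by (rule finite_subset) simp
  have pN: "p + 1 \<le> N"
    using card_mono[OF finite_verts K(1)] K(2) by (simp add: N_def)
  have enum: "p + 1 + d \<le> N \<Longrightarrow> \<exists>xs. distinct xs \<and> length xs = p + 1 + d \<and> set xs \<subseteq> verts G \<and>
      set (take (p + 1) xs) = K \<and>
      (\<forall>j. p + 1 \<le> j \<and> j < length xs \<longrightarrow> p + 1 \<le> card {i. i < j \<and> xs ! j \<rightarrow>\<^bsub>G\<^esub> xs ! i})" for d
  proof (induction d)
    case 0
    obtain xs where "set xs = K" "distinct xs"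
      using finite_distinct_list[OF finK] by blast
    moreover from this have "length xs = p + 1"
      using K(2) distinct_card by metis
    ultimately show ?case
      using K(1) by (intro exI[of _ xs]) auto
  next
    case (Suc d)
    then obtain xs where xs: "distinct xs" "length xs = p + 1 + d" "set xs \<subseteq> verts G"
        "set (take (p + 1) xs) = K"
        and later: "\<And>j. p + 1 \<le> j \<Longrightarrow> j < length xs \<Longrightarrow>
          p + 1 \<le> card {i. i < j \<and> xs ! j \<rightarrow>\<^bsub>G\<^esub> xs ! i}"
      by auto
    have "card (set xs) < card (verts G)"
      using xs Suc.prems distinct_card[of xs] by (simp add: N_def)
    then have "set xs \<subset> verts G"
      using xs(3) by auto
    moreover have "K \<subseteq> set xs"
      using xs(4) set_take_subset by metis
    ultimately obtain v where v: "v \<in> verts G" "v \<notin> set xs"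
        and nb: "p + 1 \<le> card {u \<in> set xs. v \<rightarrow>\<^bsub>G\<^esub> u}"
      using expand by blast
    have "{u \<in> set xs. v \<rightarrow>\<^bsub>G\<^esub> u} = (!) xs ` {i. i < length xs \<and> v \<rightarrow>\<^bsub>G\<^esub> xs ! i}"
      by (auto simp: in_set_conv_nth)
    then have "card {u \<in> set xs. v \<rightarrow>\<^bsub>G\<^esub> u} \<le> card {i. i < length xs \<and> v \<rightarrow>\<^bsub>G\<^esub> xs ! i}"
      by (simp add: card_image_le)
    with nb have nb': "p + 1 \<le> card {i. i < length xs \<and> v \<rightarrow>\<^bsub>G\<^esub> xs ! i}"
      by linarith
    have "p + 1 \<le> card {i. i < j \<and> (xs @ [v]) ! j \<rightarrow>\<^bsub>G\<^esub> (xs @ [v]) ! i}"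
      if j: "p + 1 \<le> j" "j < length (xs @ [v])" for j
    proof (cases "j = length xs")
      case True
      then have "{i. i < j \<and> (xs @ [v]) ! j \<rightarrow>\<^bsub>G\<^esub> (xs @ [v]) ! i} =
          {i. i < length xs \<and> v \<rightarrow>\<^bsub>G\<^esub> xs ! i}"
        by (auto simp: nth_append)
      then show ?thesis using nb' by simp
    next
      case False
      then have "{i. i < j \<and> (xs @ [v]) ! j \<rightarrow>\<^bsub>G\<^esub> (xs @ [v]) ! i} =
          {i. i < j \<and> xs ! j \<rightarrow>\<^bsub>G\<^esub> xs ! i}"
        using j by (auto simp: nth_append)
      then show ?thesis using later[of j] j False by simp
    qed
    then show ?case
      using xs v by (intro exI[of _ "xs @ [v]"]) auto
  qed
  from enum[of "N - (p + 1)"] pN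
  obtain xs where xs: "distinct xs" "length xs = N" "set xs \<subseteq> verts G"
      "set (take (p + 1) xs) = K"
      and later: "\<And>j. p + 1 \<le> j \<Longrightarrow> j < N \<Longrightarrow> p + 1 \<le> card {i. i < j \<and> xs ! j \<rightarrow>\<^bsub>G\<^esub> xs ! i}"
    by auto
  have set_xs: "set xs = verts G"
    using xs by (intro card_subset_eq) (auto simp: distinct_card N_def)
  \<comment> \<open>Lists are indexed from 0, the vertex ordering of a lateration graph from 1.\<close>
  define v where "v i = xs ! (i - 1)" for i
  have shift: "(\<lambda>i. i - 1) ` {1..m} = {..<m}" for m :: nat
    by (auto simp: image_iff intro!: bexI[of _ "Suc _"])
  have "bij_betw (\<lambda>i. i - 1) {1..N} {..<N}"
    using shift[of N] by (auto simp: bij_betw_def inj_on_def)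
  then have bij: "bij_betw v {1..N} (verts G)"
    using bij_betw_trans[OF _ bij_betw_nth[OF xs(1) refl refl], of _ "{1..N}"] xs(2) set_xs
    unfolding v_def comp_def by metis
  have "v ` {1..p + 1} = (!) xs ` {..<p + 1}"
    using shift[of "p + 1"] by (metis (no_types, lifting) image_cong image_image v_def)
  also have "\<dots> = K"
    using nth_image[of "p + 1" xs] xs pN by (simp add: atLeast0LessThan)
  finally have vK: "v ` {1..p + 1} = K" .
  have "induced_subgraph (G \<restriction> K) G"
    using K(1) by (rule induced_induce)
  then have "graph (G \<restriction> K)"
    using digraph.graphI[OF digraphI_induced] induced_graph_imp_symmetric[OF sym_arcs] by blast
  moreover have "arcs_ends (G \<restriction> K) = {(u, v). (u, v) \<in> K \<times> K \<and> u \<noteq> v}"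
    using clique no_loops by (fastforce simp: arcs_ends_conv induce_subgraph_def)
  ultimately have "complete_digraph (p + 1) (G \<restriction> (v ` {1..p + 1}))"
    using K(2) vK by (simp add: complete_digraph_def)
  moreover have "p + 1 \<le> card {i \<in> {1..<j}. v j \<rightarrow>\<^bsub>G\<^esub> v i}" if "j \<in> {p + 1<..N}" for j
  proof -
    have "p + 1 \<le> card {i. i < j - 1 \<and> xs ! (j - 1) \<rightarrow>\<^bsub>G\<^esub> xs ! i}"
      using that by (intro later) auto
    also have "\<dots> = card (Suc ` {i. i < j - 1 \<and> xs ! (j - 1) \<rightarrow>\<^bsub>G\<^esub> xs ! i})"
      by (simp add: card_image)
    also have "\<dots> \<le> card {i \<in> {1..<j}. v j \<rightarrow>\<^bsub>G\<^esub> v i}"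
      by (intro card_mono) (auto simp: v_def)
    finally show ?thesis .
  qed
  ultimately show ?thesis
    using G pN bij unfolding lateration_graph_def N_def by blast
qed

section \<open>Proximity graphs of points that fill a connected set\<close>

lemma graph_proximity_graph: "graph (proximity_graph n x r)"
proof -
  let ?A = "{(i, j). i \<in> {1..n} \<and> j \<in> {1..n} \<and> i \<noteq> j \<and> norm (x i - x j) \<le> r}"
  have fin: "finite ?A"
    by (rule finite_subset[of _ "{1..n} \<times> {1..n}"]) auto
  have "pair_graph \<lparr>pverts = {1..n}, parcs = ?A\<rparr>"
    using fin by unfold_locales (auto simp: symmetric_def norm_minus_commute intro!: symI)
  then interpret pair_graph "\<lparr>pverts = {1..n}, parcs = ?A\<rparr>" .
  show ?thesis
    unfolding proximity_graph_def by (rule graph_axioms)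
qed

text \<open>
  The deterministic core. For a set \<open>S\<close> of vertices that contains the starting clique, call a ball
  exhausted if all its sample points are in \<open>S\<close>. If \<open>S\<close> is not everything, then some ball is not
  exhausted, and connectedness of \<open>\<Omega>\<close> yields an exhausted and a non-exhausted ball that overlap
  (unless the ball of the clique is itself not exhausted, in which case the clique provides the
  neighbours). A point of the latter outside \<open>S\<close> is adjacent to all points of the former, of which
  there are at least \<open>p + 1\<close>.
\<close>

lemma lateration_proximity_graph:
  fixes y :: "nat \<Rightarrow> 'a::real_normed_vector" and \<Omega> :: "'a set"
  assumes conn: "topological_space_class.connected \<Omega>"
    and C: "C \<noteq> {}" "C \<subseteq> \<Omega>" "\<Omega> \<subseteq> (\<Union>c\<in>C. ball c s)"
    and full: "\<And>c. c \<in> C \<Longrightarrow> p + 1 \<le> card {i \<in> {1..n}. y i \<in> ball c s}"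
    and cover: "\<And>i. i \<in> {1..n} \<Longrightarrow> y i \<in> (\<Union>c\<in>C. ball c s)"
    and r: "4 * s \<le> r"
  shows "lateration_graph p (proximity_graph n y r)"
proof -
  let ?V = "{1..n}" and ?G = "proximity_graph n y r"
  define I where "I c = {i \<in> {1..n}. y i \<in> ball c s}" for c
  have near: "norm (y i - y j) \<le> r"
    if "i \<in> I c" "j \<in> I d" "z \<in> ball c s" "z \<in> ball d s" for i j c d z
  proof -
    \<comment> \<open>The path from \<open>y i\<close> through \<open>c\<close>, \<open>z\<close> and \<open>d\<close> to \<open>y j\<close> has four legs shorter than \<open>s\<close>.\<close>
    have "dist (y i) (y j) \<le> dist c (y i) + dist c z + (dist d z + dist d (y j))"
      using dist_triangle[of "y i" "y j" z] dist_triangle[of "y i" z c] dist_triangle[of z "y j" d]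
      by (simp add: dist_commute)
    also have "\<dots> \<le> 4 * s"
      using that by (simp add: I_def)
    finally show ?thesis using r by (simp add: dist_norm)
  qed
  have arc: "i \<rightarrow>\<^bsub>?G\<^esub> j" if "i \<in> I c" "j \<in> I d" "i \<noteq> j" "z \<in> ball c s" "z \<in> ball d s" for i j c d z
    using near[OF that(1,2,4,5)] that(1-3) by (auto simp: proximity_graph_def I_def)
  have verts: "verts ?G = ?V"
    by (simp add: proximity_graph_def)
  \<comment> \<open>The radius is positive, because every ball contains a sample point.\<close>
  have ball_ne: "c \<in> ball c s" if "c \<in> C" for c
  proof -
    have "I c \<noteq> {}"
      unfolding I_def using full[OF that] by (metis add_is_0 card.empty le_zero_eq one_neq_zero)
    then obtain i where "dist c (y i) < s" by (auto simp: I_def)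
    then have "0 < s" using zero_le_dist order_le_less_trans by blast
    then show ?thesis by simp
  qed
  obtain c0 where c0: "c0 \<in> C" using C(1) by blast
  have "p + 1 \<le> card (I c0)"
    unfolding I_def by (rule full[OF c0])
  then obtain K where K: "K \<subseteq> I c0" "card K = p + 1"
    by (meson obtain_subset_with_card_n)
  show ?thesis
  proof (rule lateration_graphI_expansion[OF graph_proximity_graph, of K])
    show "K \<subseteq> verts ?G" "card K = p + 1"
      using K by (auto simp: verts I_def)
    show "u \<rightarrow>\<^bsub>?G\<^esub> v" if "u \<in> K" "v \<in> K" "u \<noteq> v" for u v
      using that K(1) arc[of u c0 v c0 c0] ball_ne[OF c0] by blast
  next
    fix S assume S: "K \<subseteq> S" "S \<subset> verts ?G"
    have finS: "finite S" using S(2) finite_subset verts by auto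
    \<comment> \<open>\<open>L\<close> is to be either the starting clique or all the points of an exhausted ball.\<close>
    have many: "\<exists>v\<in>verts ?G - S. p + 1 \<le> card {u \<in> S. v \<rightarrow>\<^bsub>?G\<^esub> u}"
      if L: "L \<subseteq> I c" "L \<subseteq> S" "p + 1 \<le> card L" and d: "\<not> I d \<subseteq> S" and z: "z \<in> ball c s" "z \<in> ball d s"
      for L c d z
    proof -
      obtain v where v: "v \<in> I d" "v \<notin> S" using d by blast
      have "L \<subseteq> {u \<in> S. v \<rightarrow>\<^bsub>?G\<^esub> u}"
        using L v z arc[of v d _ c z] by blast
      then have "card L \<le> card {u \<in> S. v \<rightarrow>\<^bsub>?G\<^esub> u}"
        using finS by (intro card_mono) auto
      then have "p + 1 \<le> card {u \<in> S. v \<rightarrow>\<^bsub>?G\<^esub> u}"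
        using L(3) by linarith
      moreover have "v \<in> verts ?G - S" using v by (auto simp: I_def verts)
      ultimately show ?thesis by blast
    qed
    define D where "D = {c \<in> C. I c \<subseteq> S}"
    show "\<exists>v\<in>verts ?G - S. p + 1 \<le> card {u \<in> S. v \<rightarrow>\<^bsub>?G\<^esub> u}"
    proof (cases "c0 \<in> D")
      case False
      then have "\<not> I c0 \<subseteq> S" using c0 by (simp add: D_def)
      then show ?thesis
        using many[of K c0 c0 c0] K S(1) ball_ne[OF c0] by simp
    next
      case True
      have "\<exists>i\<in>?V. i \<notin> S" using S(2) verts by auto
      then obtain d where d: "d \<in> C" "d \<notin> D"
        using cover by (fastforce simp: D_def I_def)
      let ?U = "\<Union>c\<in>D. ball c s" and ?W = "\<Union>c\<in>C - D. ball c s"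
      have "open ?U" "open ?W" by auto
      moreover have "\<Omega> \<subseteq> ?U \<union> ?W" using C(3) by auto
      moreover have "?U \<inter> \<Omega> \<noteq> {}" "?W \<inter> \<Omega> \<noteq> {}"
        using True c0 d C(2) ball_ne by blast+
      ultimately have "?U \<inter> ?W \<inter> \<Omega> \<noteq> {}"
        using connectedD[OF conn, of ?U ?W] by metis
      then obtain z c d' where z: "c \<in> D" "d' \<in> C - D" "z \<in> ball c s" "z \<in> ball d' s"
        by blast
      then show ?thesis
        using many[of "I c" c d' z] full[of c] unfolding D_def I_def by blast
    qed
  qed
qed

section \<open>Covering the support\<close>

text \<open>
  By definition the complement of the support is a union of open null sets, possibly an
  uncountable one; second countability reduces it to a countable one.
\<close>

lemma null_sets_Compl_measure_support:
  fixes P :: "'a::second_countable_topology measure"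
  assumes "sets P = sets borel"
  shows "- measure_support P \<in> null_sets P"
proof -
  define F where "F = {U. open U \<and> emeasure P U = 0}"
  obtain F' where F': "F' \<subseteq> F" "countable F'" "\<Union>F' = \<Union>F"
    using Lindelof[of F] by (auto simp: F_def)
  have "(\<Union>U\<in>F'. U) \<in> null_sets P"
    using F'(1,2) assms by (intro null_sets_UN') (auto simp: F_def null_sets_def)
  also have "(\<Union>U\<in>F'. U) = - measure_support P"
    using F'(3) by (auto simp: F_def measure_support_def)
  finally show ?thesis .
qed

text \<open>
  The centres are chosen in \<open>\<Omega>\<close> rather than in its closure, so that in the connectedness argument
  every ball of the cover meets \<open>\<Omega>\<close>.
\<close>

lemma ball_cover_within_support:
  fixes P :: "'a::euclidean_space measure"
  assumes P: "prob_space P" "sets P = sets borel"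
    and \<Omega>: "bounded \<Omega>"
    and supp: "measure_support P = closure \<Omega>"
    and s: "0 < s"
  obtains C where "finite C" "C \<noteq> {}" "C \<subseteq> \<Omega>" "\<Omega> \<subseteq> (\<Union>c\<in>C. ball c s)"
    "- (\<Union>c\<in>C. ball c s) \<in> null_sets P" "\<And>c. c \<in> C \<Longrightarrow> 0 < measure P (ball c s)"
proof -
  interpret P: prob_space P by (rule P(1))
  have null: "- closure \<Omega> \<in> null_sets P"
    using null_sets_Compl_measure_support[OF P(2)] supp by simp
  have "compact (closure \<Omega>)"
    using \<Omega> by (simp add: compact_closure)
  moreover have "closure \<Omega> \<subseteq> (\<Union>c\<in>\<Omega>. ball c s)"
    using s by (auto simp: closure_approachable)
  ultimately obtain C where C: "C \<subseteq> \<Omega>" "finite C" "closure \<Omega> \<subseteq> (\<Union>c\<in>C. ball c s)"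
    using compactE_image[of "closure \<Omega>" \<Omega> "\<lambda>c. ball c s"] by blast
  have C_null: "- (\<Union>c\<in>C. ball c s) \<in> null_sets P"
  proof (rule null_sets_subset[OF null])
    show "- (\<Union>c\<in>C. ball c s) \<in> sets P"
      unfolding P(2) by (intro borel_comp borel_open open_UN) simp
  qed (use C(3) in blast)
  have space: "space P = UNIV"
    using sets_eq_imp_space_eq[OF P(2)] by simp
  show thesis
  proof (rule that[OF C(2) _ C(1) _ C_null])
    show "C \<noteq> {}"
      using C_null space P.emeasure_space_1 by (auto simp: null_sets_def)
    show "\<Omega> \<subseteq> (\<Union>c\<in>C. ball c s)"
      using C(3) closure_subset by blast
    show "0 < measure P (ball c s)" if "c \<in> C" for c
    proof -
      have "c \<in> measure_support P"
        using that C(1) supp closure_subset by blast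
      then have "0 < emeasure P (ball c s)"
        using s by (auto simp: measure_support_def)
      then show ?thesis
        by (simp add: P.emeasure_eq_measure)
    qed
  qed
qed

section \<open>Failure probability at a fixed scale\<close>

text \<open>
  The proximity graph of \<open>n\<close> points takes only finitely many values, and each of them is attained on
  a measurable event. Without this lemma \<open>measure\<close> could take its default value 0 on the event of
  interest.
\<close>

lemma sets_lateration_proximity_graph:
  fixes x :: "nat \<Rightarrow> 'w \<Rightarrow> 'a::{second_countable_topology, real_normed_vector}"
  assumes x: "\<And>i. i \<in> {1..n} \<Longrightarrow> x i \<in> borel_measurable M"
  shows "{\<omega> \<in> space M. lateration_graph p (proximity_graph n (\<lambda>i. x i \<omega>) r)} \<in> sets M"
proof -
  let ?V = "{1..n}"
  define H :: "(nat \<times> nat) set \<Rightarrow> (nat, nat \<times> nat) pre_digraph"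
    where "H E = with_proj \<lparr>pverts = {1..n}, parcs = E\<rparr>" for E
  define E where "E \<omega> = {(i, j). i \<in> ?V \<and> j \<in> ?V \<and> i \<noteq> j \<and> norm (x i \<omega> - x j \<omega>) \<le> r}" for \<omega>
  have "{\<omega> \<in> space M. E \<omega> = A} \<in> sets M" if A: "A \<subseteq> ?V \<times> ?V" for A
  proof -
    have "{\<omega> \<in> space M. E \<omega> = A} =
        {\<omega> \<in> space M. \<forall>e\<in>?V \<times> ?V. (fst e \<noteq> snd e \<and> norm (x (fst e) \<omega> - x (snd e) \<omega>) \<le> r) \<longleftrightarrow> e \<in> A}"
      using A unfolding E_def by fastforce
    also have "\<dots> \<in> sets M"
    proof (rule sets.sets_Collect_finite_All)
      fix e assume "e \<in> ?V \<times> ?V"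
      then have [measurable]: "x (fst e) \<in> borel_measurable M" "x (snd e) \<in> borel_measurable M"
        by (auto intro!: x)
      show "{\<omega> \<in> space M. (fst e \<noteq> snd e \<and> norm (x (fst e) \<omega> - x (snd e) \<omega>) \<le> r) \<longleftrightarrow> e \<in> A} \<in> sets M"
        by measurable
    qed simp
    finally show ?thesis .
  qed
  then have "(\<Union>A\<in>{A \<in> Pow (?V \<times> ?V). lateration_graph p (H A)}. {\<omega> \<in> space M. E \<omega> = A}) \<in> sets M"
    by (intro sets.finite_UN) auto
  also have "(\<Union>A\<in>{A \<in> Pow (?V \<times> ?V). lateration_graph p (H A)}. {\<omega> \<in> space M. E \<omega> = A}) =
      {\<omega> \<in> space M. lateration_graph p (H (E \<omega>))}"
    by (auto simp: E_def)
  finally show ?thesis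
    by (simp add: H_def E_def proximity_graph_def)
qed

lemma (in prob_space) prob_no_hit:
  assumes indep: "indep_vars (\<lambda>_. borel) X I"
    and J: "finite J" "J \<subseteq> I"
    and distr: "\<And>i. i \<in> J \<Longrightarrow> distr M borel (X i) = P"
    and A: "A \<in> sets borel"
  shows "prob {\<omega> \<in> space M. \<forall>i\<in>J. X i \<omega> \<notin> A} = (1 - measure P A) ^ card J"
proof (cases "J = {}")
  case True
  then show ?thesis by (simp add: prob_space)
next
  case False
  have meas: "X i \<in> borel_measurable M" if "i \<in> J" for i
    using indep J(2) that by (auto simp: indep_vars_def)
  have miss: "prob (X i -` (- A) \<inter> space M) = 1 - measure P A" if "i \<in> J" for i
  proof -
    have "measure P A = prob (X i -` A \<inter> space M)"
      using measure_distr[OF meas[OF that] A] distr[OF that] by simp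
    moreover have "X i -` (- A) \<inter> space M = space M - (X i -` A \<inter> space M)"
      by auto
    ultimately show ?thesis
      using prob_compl[OF measurable_sets[OF meas[OF that] A]] by simp
  qed
  have "{\<omega> \<in> space M. \<forall>i\<in>J. X i \<omega> \<notin> A} = (\<Inter>i\<in>J. X i -` (- A) \<inter> space M)"
    using False by auto
  also have "prob \<dots> = (\<Prod>i\<in>J. prob (X i -` (- A) \<inter> space M))"
    using A by (intro indep_varsD[OF indep False J]) auto
  also have "\<dots> = (1 - measure P A) ^ card J"
    using miss by simp
  finally show ?thesis .
qed

text \<open>
  Cut the sample into \<open>k\<close> disjoint blocks of length \<open>n div k\<close>. If every block hits \<open>A\<close>, there are at
  least \<open>k\<close> hits, and by independence one given block misses \<open>A\<close> with probability
  \<open>(1 - measure P A) ^ (n div k)\<close>; the union bound over the blocks replaces an estimate of binomial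
  tails. The statement is about an exceptional event \<open>B\<close> so that it can be combined by union bounds.
\<close>

lemma (in prob_space) few_hits_unlikely:
  assumes indep: "indep_vars (\<lambda>_. borel) X {1..n}"
    and distr: "\<And>i. i \<in> {1..n} \<Longrightarrow> distr M borel (X i) = P"
    and A: "A \<in> sets borel"
  shows "\<exists>B\<in>events. prob B \<le> real k * (1 - measure P A) ^ (n div k) \<and>
    (\<forall>\<omega>\<in>space M - B. k \<le> card {i \<in> {1..n}. X i \<omega> \<in> A})"
proof -
  define m where "m = n div k"
  define J where "J b = {b * m + 1..(b + 1) * m}" for b
  have J_sub: "J b \<subseteq> {1..n}" if "b < k" for b
  proof -
    have "(b + 1) * m \<le> k * m" using that by (intro mult_right_mono) auto
    also have "\<dots> \<le> n" by (simp add: m_def)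
    finally show ?thesis by (auto simp: J_def)
  qed
  have card_J: "card (J b) = m" for b by (simp add: J_def)
  define miss where "miss b = {\<omega> \<in> space M. \<forall>i\<in>J b. X i \<omega> \<notin> A}" for b
  have miss_sets: "miss b \<in> events" if "b < k" for b
    unfolding miss_def
  proof (rule sets.sets_Collect_finite_All)
    fix i assume "i \<in> J b"
    then have [measurable]: "X i \<in> borel_measurable M"
      using indep J_sub[OF that] by (auto simp: indep_vars_def)
    show "{\<omega> \<in> space M. X i \<omega> \<notin> A} \<in> events"
      using A by measurable
  qed (simp add: J_def)
  have prob_miss: "prob (miss b) = (1 - measure P A) ^ m" if "b < k" for b
    unfolding miss_def card_J[of b, symmetric]
    using J_sub[OF that] by (intro prob_no_hit[OF indep _ _ distr A]) (auto simp: J_def)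
  show ?thesis
  proof (intro bexI[of _ "\<Union>b<k. miss b"] conjI ballI)
    show "(\<Union>b<k. miss b) \<in> events" using miss_sets by auto
    have "prob (\<Union>b<k. miss b) \<le> (\<Sum>b<k. prob (miss b))"
      using miss_sets by (intro finite_measure_subadditive_finite) auto
    also have "\<dots> = real k * (1 - measure P A) ^ (n div k)"
      using prob_miss by (simp add: m_def)
    finally show "prob (\<Union>b<k. miss b) \<le> real k * (1 - measure P A) ^ (n div k)" .
  next
    fix \<omega> assume "\<omega> \<in> space M - (\<Union>b<k. miss b)"
    then have "\<forall>b\<in>{..<k}. \<exists>i. i \<in> J b \<and> X i \<omega> \<in> A"
      by (auto simp: miss_def)
    then obtain f where f: "\<And>b. b < k \<Longrightarrow> f b \<in> J b \<and> X (f b) \<omega> \<in> A"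
      using bchoice[of "{..<k}" "\<lambda>b i. i \<in> J b \<and> X i \<omega> \<in> A"] by auto
    \<comment> \<open>The position of an index determines its block, hence hits in different blocks are distinct.\<close>
    have J_div: "(i - 1) div m = b" if "i \<in> J b" for i b
      using that by (intro div_nat_eqI) (auto simp: J_def algebra_simps)
    have "inj_on f {..<k}"
      by (rule inj_onI) (metis J_div f lessThan_iff)
    then have "k = card (f ` {..<k})" by (simp add: card_image)
    also have "\<dots> \<le> card {i \<in> {1..n}. X i \<omega> \<in> A}"
    proof (rule card_mono)
      show "f ` {..<k} \<subseteq> {i \<in> {1..n}. X i \<omega> \<in> A}"
        using f J_sub by blast
    qed simp
    finally show "k \<le> card {i \<in> {1..n}. X i \<omega> \<in> A}" .
  qed
qed

text \<open>
  The bound depends on \<open>n\<close> and the cover but not on \<open>r\<close>. That gives the convergence for all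
  sequences of radii above the threshold at once.
\<close>

lemma (in prob_space) prob_lateration_proximity_graph:
  fixes X :: "nat \<Rightarrow> 'a \<Rightarrow> 'b::{second_countable_topology, real_normed_vector}"
  assumes indep: "indep_vars (\<lambda>_. borel) X {1..n}"
    and distr: "\<And>i. i \<in> {1..n} \<Longrightarrow> distr M borel (X i) = P"
    and conn: "topological_space_class.connected \<Omega>"
    and C: "finite C" "C \<noteq> {}" "C \<subseteq> \<Omega>" "\<Omega> \<subseteq> (\<Union>c\<in>C. ball c s)"
    and null: "- (\<Union>c\<in>C. ball c s) \<in> null_sets P"
    and r: "4 * s \<le> r"
  shows "1 - (\<Sum>c\<in>C. real (p + 1) * (1 - measure P (ball c s)) ^ (n div (p + 1)))
    \<le> prob {\<omega> \<in> space M. lateration_graph p (proximity_graph n (\<lambda>i. X i \<omega>) r)}"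
proof -
  let ?U = "\<Union>c\<in>C. ball c s"
  let ?q = "\<lambda>c. real (p + 1) * (1 - measure P (ball c s)) ^ (n div (p + 1))"
  let ?L = "{\<omega> \<in> space M. lateration_graph p (proximity_graph n (\<lambda>i. X i \<omega>) r)}"
  have meas: "X i \<in> borel_measurable M" if "i \<in> {1..n}" for i
    using indep that by (auto simp: indep_vars_def)
  have "\<exists>B. \<forall>c. B c \<in> events \<and> prob (B c) \<le> ?q c \<and>
      (\<forall>\<omega>\<in>space M - B c. p + 1 \<le> card {i \<in> {1..n}. X i \<omega> \<in> ball c s})"
    by (intro choice allI few_hits_unlikely[OF indep distr, unfolded Bex_def]) simp_all
  then obtain B where "\<forall>c. B c \<in> events \<and> prob (B c) \<le> ?q c \<and>
      (\<forall>\<omega>\<in>space M - B c. p + 1 \<le> card {i \<in> {1..n}. X i \<omega> \<in> ball c s})" ..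
  then have B: "\<And>c. B c \<in> events" "\<And>c. prob (B c) \<le> ?q c"
      and hits: "\<And>c \<omega>. \<omega> \<in> space M - B c \<Longrightarrow> p + 1 \<le> card {i \<in> {1..n}. X i \<omega> \<in> ball c s}"
    by simp_all
  define N where "N = (\<Union>i\<in>{1..n}. X i -` (- ?U) \<inter> space M)"
  have "X i -` (- ?U) \<inter> space M \<in> null_sets M" if i: "i \<in> {1..n}" for i
  proof -
    have U: "- ?U \<in> sets borel"
      by (intro borel_comp borel_open open_UN) simp
    have "emeasure M (X i -` (- ?U) \<inter> space M) = emeasure P (- ?U)"
      using emeasure_distr[OF meas[OF i] U] distr[OF i] by simp
    also have "\<dots> = 0"
      using null by (rule null_setsD1)
    finally show ?thesis
      using measurable_sets[OF meas[OF i] U] by (rule null_setsI)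
  qed
  then have N: "N \<in> null_sets M"
    unfolding N_def by (intro null_sets_UN') auto
  have "1 - (\<Sum>c\<in>C. ?q c) \<le> 1 - prob (N \<union> (\<Union>c\<in>C. B c))"
  proof -
    have "prob (N \<union> (\<Union>c\<in>C. B c)) \<le> prob N + prob (\<Union>c\<in>C. B c)"
      using N B(1) C(1) by (intro measure_Un_le) auto
    also have "prob N = 0"
      using N by (simp add: null_sets_def measure_def)
    also have "prob (\<Union>c\<in>C. B c) \<le> (\<Sum>c\<in>C. prob (B c))"
      using B(1) C(1) by (intro finite_measure_subadditive_finite) auto
    also have "\<dots> \<le> (\<Sum>c\<in>C. ?q c)"
      by (intro sum_mono B(2))
    finally show ?thesis by simp
  qed
  also have "\<dots> = prob (space M - (N \<union> (\<Union>c\<in>C. B c)))"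
    using N B(1) C(1) by (intro prob_compl[symmetric]) auto
  also have "\<dots> \<le> prob ?L"
  proof (rule finite_measure_mono)
    show "?L \<in> events"
      by (rule sets_lateration_proximity_graph[OF meas])
    show "space M - (N \<union> (\<Union>c\<in>C. B c)) \<subseteq> ?L"
    proof
      fix \<omega> assume \<omega>: "\<omega> \<in> space M - (N \<union> (\<Union>c\<in>C. B c))"
      have "lateration_graph p (proximity_graph n (\<lambda>i. X i \<omega>) r)"
      proof (rule lateration_proximity_graph[OF conn C(2-4) _ _ r])
        show "p + 1 \<le> card {i \<in> {1..n}. X i \<omega> \<in> ball c s}" if "c \<in> C" for c
          using \<omega> that by (intro hits) auto
        show "X i \<omega> \<in> ?U" if "i \<in> {1..n}" for i
          using \<omega> that by (auto simp: N_def)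
      qed
      then show "\<omega> \<in> ?L" using \<omega> by simp
    qed
  qed
  finally show ?thesis .
qed

section \<open>Letting the scale tend to zero\<close>

text \<open>
  Fix for each \<open>m\<close> a threshold \<open>N m\<close> from which on \<open>h m\<close> stays below \<open>1 / (m + 1)\<close>; then \<open>k n\<close> can be
  the largest \<open>m \<le> n\<close> whose threshold has been reached at \<open>n\<close>.
\<close>

lemma vanishing_diagonal:
  fixes h :: "nat \<Rightarrow> nat \<Rightarrow> real"
  assumes "\<And>m. h m \<longlonglongrightarrow> 0"
  obtains k where "filterlim k at_top sequentially" "(\<lambda>n. h (k n) n) \<longlonglongrightarrow> 0"
proof -
  have "\<forall>m. \<exists>N. \<forall>n\<ge>N. norm (h m n) < 1 / (real m + 1)"
  proof
    fix m
    show "\<exists>N. \<forall>n\<ge>N. norm (h m n) < 1 / (real m + 1)"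
      using LIMSEQ_D[OF assms[of m], of "1 / (real m + 1)"] by simp
  qed
  then obtain N where N: "\<And>m n. N m \<le> n \<Longrightarrow> norm (h m n) < 1 / (real m + 1)"
    by metis
  \<comment> \<open>Inserting 0 makes the maximum meaningful for \<open>n < N 0\<close>, where the set may be empty.\<close>
  define k where "k n = Max (insert 0 {m. m \<le> n \<and> N m \<le> n})" for n
  have k_ge: "m \<le> k n" if "m \<le> n" "N m \<le> n" for m n
    unfolding k_def using that by (intro Max_ge) auto
  have k_N: "N (k n) \<le> n" if "N 0 \<le> n" for n
    using Max_in[of "insert 0 {m. m \<le> n \<and> N m \<le> n}"] that by (auto simp: k_def[symmetric])
  have lim: "filterlim k at_top sequentially"
    unfolding filterlim_at_top eventually_sequentially
    by (metis k_ge max.bounded_iff)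
  moreover have "(\<lambda>n. h (k n) n) \<longlonglongrightarrow> 0"
  proof (rule Lim_null_comparison)
    show "\<forall>\<^sub>F n in sequentially. norm (h (k n) n) \<le> 1 / (real (k n) + 1)"
      using eventually_ge_at_top[of "N 0"] by eventually_elim (use N k_N in \<open>auto simp: less_imp_le\<close>)
    have "(\<lambda>m. 1 / (real m + 1)) \<longlonglongrightarrow> 0"
      using LIMSEQ_inverse_real_of_nat by (simp add: inverse_eq_divide add.commute)
    then show "(\<lambda>n. 1 / (real (k n) + 1)) \<longlonglongrightarrow> 0"
      by (rule filterlim_compose) (rule lim)
  qed
  ultimately show thesis by (rule that)
qed

theorem theorem4p1:
  fixes P :: "(real ^ 'p) measure"
    and \<Omega> :: "(real ^ 'p) set"
    and M :: "nat \<Rightarrow> 'w measure"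
    and x :: "nat \<Rightarrow> nat \<Rightarrow> 'w \<Rightarrow> real ^ 'p"
  assumes "prob_space P" and "sets P = sets borel"
    and "bounded \<Omega>" and "open \<Omega>" and "topological_space_class.connected \<Omega>"
    and "measure_support P = closure \<Omega>"
    and "\<And>n. prob_space (M n)"
    and "\<And>n. prob_space.indep_vars (M n) (\<lambda>_. borel) (x n) {1..n}"
    and "\<And>n i. i \<in> {1..n} \<Longrightarrow> distr (M n) borel (x n i) = P"
  shows "\<exists>\<rho> :: nat \<Rightarrow> real. \<rho> \<longlonglongrightarrow> 0 \<and>
    (\<forall>r :: nat \<Rightarrow> real. (\<forall>n. \<rho> n \<le> r n) \<longrightarrow>
      (\<lambda>n. measure (M n) {\<omega> \<in> space (M n).
         lateration_graph CARD('p) (proximity_graph n (\<lambda>i. x n i \<omega>) (r n))})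
      \<longlonglongrightarrow> 1)"
proof -
  let ?p = "CARD('p)"
  let ?L = "\<lambda>n r. {\<omega> \<in> space (M n). lateration_graph ?p (proximity_graph n (\<lambda>i. x n i \<omega>) r)}"
  define s where "s m = 1 / (real m + 1)" for m
  have s_pos: "0 < s m" for m by (simp add: s_def)
  have "\<forall>m. \<exists>C. finite C \<and> C \<noteq> {} \<and> C \<subseteq> \<Omega> \<and> \<Omega> \<subseteq> (\<Union>c\<in>C. ball c (s m)) \<and>
      - (\<Union>c\<in>C. ball c (s m)) \<in> null_sets P \<and> (\<forall>c\<in>C. 0 < measure P (ball c (s m)))"
  proof
    fix m
    from ball_cover_within_support[OF assms(1-3,6) s_pos[of m]]
    show "\<exists>C. finite C \<and> C \<noteq> {} \<and> C \<subseteq> \<Omega> \<and> \<Omega> \<subseteq> (\<Union>c\<in>C. ball c (s m)) \<and>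
      - (\<Union>c\<in>C. ball c (s m)) \<in> null_sets P \<and> (\<forall>c\<in>C. 0 < measure P (ball c (s m)))"
      by metis
  qed
  then obtain C where C: "\<And>m. finite (C m)" "\<And>m. C m \<noteq> {}" "\<And>m. C m \<subseteq> \<Omega>"
      "\<And>m. \<Omega> \<subseteq> (\<Union>c\<in>C m. ball c (s m))" "\<And>m. - (\<Union>c\<in>C m. ball c (s m)) \<in> null_sets P"
      and pos: "\<And>m c. c \<in> C m \<Longrightarrow> 0 < measure P (ball c (s m))"
    by metis
  define h where
    "h m n = (\<Sum>c\<in>C m. real (?p + 1) * (1 - measure P (ball c (s m))) ^ (n div (?p + 1)))" for m n
  have div_lim: "filterlim (\<lambda>n. n div (?p + 1)) at_top sequentially"
    unfolding filterlim_at_top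
  proof
    fix Z :: nat
    show "\<forall>\<^sub>F n in sequentially. Z \<le> n div (?p + 1)"
      using eventually_ge_at_top[of "Z * (?p + 1)"]
      by eventually_elim (simp add: less_eq_div_iff_mult_less_eq)
  qed
  have h_lim: "h m \<longlonglongrightarrow> 0" for m
  proof -
    have "(\<lambda>n. real (?p + 1) * (1 - measure P (ball c (s m))) ^ (n div (?p + 1))) \<longlonglongrightarrow> 0"
      if "c \<in> C m" for c
    proof -
      have "(\<lambda>n. (1 - measure P (ball c (s m))) ^ n) \<longlonglongrightarrow> 0"
        using pos[OF that] prob_space.prob_le_1[OF assms(1)] by (intro LIMSEQ_power_zero) simp
      then have "(\<lambda>n. (1 - measure P (ball c (s m))) ^ (n div (?p + 1))) \<longlonglongrightarrow> 0"
        by (rule filterlim_compose) (rule div_lim)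
      then show ?thesis
        by (rule tendsto_mult_right_zero)
    qed
    then show ?thesis
      unfolding h_def by (intro tendsto_null_sum)
  qed
  obtain k where k: "filterlim k at_top sequentially" "(\<lambda>n. h (k n) n) \<longlonglongrightarrow> 0"
    using vanishing_diagonal[OF h_lim] .
  \<comment> \<open>Overlapping balls of radius \<open>s\<close> contain points up to distance \<open>4 * s\<close> apart.\<close>
  define \<rho> where "\<rho> n = 4 * s (k n)" for n
  have "s \<longlonglongrightarrow> 0"
    using LIMSEQ_inverse_real_of_nat by (simp add: s_def[abs_def] inverse_eq_divide add.commute)
  then have "\<rho> \<longlonglongrightarrow> 0"
    unfolding \<rho>_def by (intro tendsto_mult_right_zero filterlim_compose[OF _ k(1)])
  moreover have "(\<lambda>n. measure (M n) (?L n (r n))) \<longlonglongrightarrow> 1" if r: "\<And>n. \<rho> n \<le> r n" for r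
  proof (rule tendsto_sandwich)
    have "1 - h (k n) n \<le> measure (M n) (?L n (r n))" for n
      unfolding h_def
      by (rule prob_space.prob_lateration_proximity_graph[OF assms(7,8,9,5) C])
        (use r[of n] in \<open>simp_all add: \<rho>_def\<close>)
    then show "\<forall>\<^sub>F n in sequentially. 1 - h (k n) n \<le> measure (M n) (?L n (r n))"
      by simp
    show "\<forall>\<^sub>F n in sequentially. measure (M n) (?L n (r n)) \<le> 1"
      using prob_space.prob_le_1[OF assms(7)] by simp
    show "(\<lambda>n. 1 - h (k n) n) \<longlonglongrightarrow> 1"
      using tendsto_diff[OF tendsto_const k(2), of 1] by simp
  qed simp
  ultimately show ?thesis
    by blast
qed

end
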